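(* Let $D$ be a domain in $\mathbb{R}^n$, $n\geqslant 2$, and let $p>n-1$. If $A$ and $A^{*}$ are nondegenerate continua in $D$, then $M_p(\Gamma(A,A^{*},D))>0$.
   Context: A continuum is a compact connected set; it is nondegenerate if it contains more than one point. For sets $E_0,E_1\subset\overline{\mathbb{R}^n}=\mathbb{R}^n\cup\{\infty\}$ and a domain $D$, $\Gamma(E_0,E_1,D)$ denotes the family of all paths joining $E_0$ and $E_1$ in $D$, i.e. continuous $\gamma:[a,b]\to\overline{\mathbb{R}^n}$ with $\gamma(a)\in E_0$, $\gamma(b)\in E_1$ and $\gamma(t)\in D$ for $a<t<b$. A Borel function $\rho:\mathbb{R}^n\to[0,\infty]$ is admissible for a family $\Gamma$ of paths, written $\rho\in\mathrm{adm}\,\Gamma$, if $\int_\gamma\rho(x)\,|dx|\geqslant 1$ for every locally rectifiable path $\gamma\in\Gamma$. For $p\geqslant 1$ the $p$-modulus of $\Gamma$ is $M_p(\Gamma)=\inf_{\rho\in\mathrm{adm}\,\Gamma}\int_{\mathbb{R}^n}\rho^p(x)\,dm(x)$, where $m$ is Lebesgue measure. A family containing a constant path has infinite $p$-modulus (no admissible functions, $\inf\varnothing=\infty$). *)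

theory Defs
  imports "HOL-Analysis.Analysis"
begin

definition nondegenerate_continuum :: "'a::topological_space set \<Rightarrow> bool" where
  "nondegenerate_continuum A \<longleftrightarrow>
     compact A \<and> connected A \<and> (\<exists>x\<in>A. \<exists>y\<in>A. x \<noteq> y)"

text \<open>A path on a compact interval is represented by a triple \<open>(a, b, \<gamma>)\<close> with \<open>a < b\<close>;
  the values of \<open>\<gamma>\<close> outside \<open>{a..b}\<close> are irrelevant.  Only paths in finite
  Euclidean space occur, the point at infinity is not modelled.\<close>

definition joining_paths ::
    "'a::topological_space set \<Rightarrow> 'a set \<Rightarrow> 'a set \<Rightarrow> (real \<times> real \<times> (real \<Rightarrow> 'a)) set" where
  "joining_paths E\<^sub>0 E\<^sub>1 D =
     {(a, b, \<gamma>). a < b \<and> continuous_on {a..b} \<gamma> \<and> \<gamma> a \<in> E\<^sub>0 \<and> \<gamma> b \<in> E\<^sub>1 \<and>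
                 (\<forall>t. a < t \<and> t < b \<longrightarrow> \<gamma> t \<in> D)}"

text \<open>The length is the supremum of the lengths of inscribed polygons; an inscribed
  polygon is given by a sorted list of parameters in \<open>{a..b}\<close>.\<close>

definition curve_length :: "real \<Rightarrow> real \<Rightarrow> (real \<Rightarrow> 'a::metric_space) \<Rightarrow> ennreal" where
  "curve_length a b \<gamma> =
     (SUP ts\<in>{ts. sorted ts \<and> set ts \<subseteq> {a..b}}.
        \<Sum>i<length ts - 1. ennreal (dist (\<gamma> (ts ! i)) (\<gamma> (ts ! Suc i))))"

text \<open>Every closed subpath has finite length.  On a compact parameter interval this amounts
  to finite length of the path itself.\<close>

definition locally_rectifiable :: "real \<Rightarrow> real \<Rightarrow> (real \<Rightarrow> 'a::metric_space) \<Rightarrow> bool" where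
  "locally_rectifiable a b \<gamma> \<longleftrightarrow>
     (\<forall>c d. a \<le> c \<and> c \<le> d \<and> d \<le> b \<longrightarrow> curve_length c d \<gamma> < \<infinity>)"

text \<open>The arc length (normal) representation of a rectifiable path, a function on
  \<open>{0..l}\<close> where \<open>l\<close> is the length: its value at \<open>s\<close> is \<open>\<gamma> t\<close> for any \<open>t\<close> with
  \<open>curve_length a t \<gamma> = s\<close>.  The choice of \<open>t\<close> made by \<open>inv_into\<close> is immaterial, since
  \<open>\<gamma>\<close> is constant wherever the length function is.\<close>

definition arc_length_rep :: "real \<Rightarrow> real \<Rightarrow> (real \<Rightarrow> 'a::metric_space) \<Rightarrow> real \<Rightarrow> 'a" where
  "arc_length_rep a b \<gamma> = \<gamma> \<circ> inv_into {a..b} (\<lambda>t. enn2real (curve_length a t \<gamma>))"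

text \<open>The integral of \<open>\<rho>\<close> along \<open>\<gamma>\<close> with respect to arc length; meaningful for rectifiable \<open>\<gamma>\<close>.\<close>

definition path_integral ::
    "real \<Rightarrow> real \<Rightarrow> (real \<Rightarrow> 'a::metric_space) \<Rightarrow> ('a \<Rightarrow> ennreal) \<Rightarrow> ennreal" where
  "path_integral a b \<gamma> \<rho> =
     (\<integral>\<^sup>+ s\<in>{0..enn2real (curve_length a b \<gamma>)}. \<rho> (arc_length_rep a b \<gamma> s) \<partial>lborel)"

definition adm :: "(real \<times> real \<times> (real \<Rightarrow> 'a::metric_space)) set \<Rightarrow> ('a \<Rightarrow> ennreal) set" where
  "adm \<Gamma> = {\<rho>\<in>borel_measurable borel.
      \<forall>(a, b, \<gamma>)\<in>\<Gamma>. locally_rectifiable a b \<gamma> \<longrightarrow> path_integral a b \<gamma> \<rho> \<ge> 1}"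

text \<open>Real powers on \<open>[0, \<infinity>]\<close>, for positive exponents only.\<close>

definition ennreal_rpow :: "ennreal \<Rightarrow> real \<Rightarrow> ennreal" where
  "ennreal_rpow x p = (if x = \<infinity> then \<infinity> else ennreal (enn2real x powr p))"

text \<open>The infimum over the empty set is \<open>\<infinity>\<close> in \<^typ>\<open>ennreal\<close>, so a family
  containing a constant path has infinite modulus.\<close>

definition modulus ::
    "real \<Rightarrow> (real \<times> real \<times> (real \<Rightarrow> 'a::euclidean_space)) set \<Rightarrow> ennreal" where
  "modulus p \<Gamma> = (INF \<rho>\<in>adm \<Gamma>. \<integral>\<^sup>+ x. ennreal_rpow (\<rho> x) p \<partial>lborel)"

end

(* Let rho be admissible with small energy E, the integral of rho^p. A Vitali covering argument,
   applied to the 1-Lipschitz function dist a which maps A near a onto an interval, yields a point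
   x of A near a such that the integral of rho^p over B(x,s) is at most a small multiple of s for
   all small s; likewise a point y of A' near a'. Fix a smooth path g in D from a to a'. For a
   random small vector u, run along the segment from x to a + u, along the translated path g + u,
   and along the segment from a' + u to y. Averaged over u, the integral of rho along this path is
   small: on the segments the average at time t is of order t^(-(n-1)/p), which is integrable
   because p > n - 1. So some u gives a path on which rho integrates to less than 1. *)

theory Submission
  imports Defs
begin

section \<open>Lengths of inscribed polygons and of Lipschitz paths\<close>

text \<open>The sum under the supremum in \<open>curve_length\<close>, named so that its recursion
  on the parameter list is available for induction.\<close>

definition polygon_length :: "(real \<Rightarrow> 'a::metric_space) \<Rightarrow> real list \<Rightarrow> ennreal" where
  "polygon_length \<gamma> ts = (\<Sum>i<length ts - 1. ennreal (dist (\<gamma> (ts ! i)) (\<gamma> (ts ! Suc i))))"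

lemma polygon_length_simps [simp]:
  "polygon_length \<gamma> [] = 0"
  "polygon_length \<gamma> [s] = 0"
  "polygon_length \<gamma> (s # t # ts) = ennreal (dist (\<gamma> s) (\<gamma> t)) + polygon_length \<gamma> (t # ts)"
  by (auto simp: polygon_length_def sum.lessThan_Suc_shift simp del: sum.lessThan_Suc)

lemma curve_length_eq_SUP_polygon_length:
  "curve_length a b \<gamma> = (SUP ts\<in>{ts. sorted ts \<and> set ts \<subseteq> {a..b}}. polygon_length \<gamma> ts)"
  by (simp add: curve_length_def polygon_length_def)

lemma polygon_length_le_curve_length:
  "sorted ts \<Longrightarrow> set ts \<subseteq> {a..b} \<Longrightarrow> polygon_length \<gamma> ts \<le> curve_length a b \<gamma>"
  unfolding curve_length_eq_SUP_polygon_length by (rule SUP_upper) simp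

lemma polygon_length_Cons_ge: "polygon_length \<gamma> ts \<le> polygon_length \<gamma> (t # ts)"
  by (cases ts) auto

text \<open>Inserting \<open>t\<close> affects at most the edge from the last point of
  \<open>us\<close> to the first point of \<open>vs\<close>, where the triangle inequality applies.
  Hence cutting a polygon at a new point never loses length.\<close>

lemma polygon_length_split:
  "polygon_length \<gamma> (us @ vs) \<le> polygon_length \<gamma> (us @ [t]) + polygon_length \<gamma> (t # vs)"
proof (induction us)
  case Nil
  then show ?case by (simp add: polygon_length_Cons_ge)
next
  case (Cons u us)
  show ?case
  proof (cases us)
    case Nil
    show ?thesis
    proof (cases vs)
      case (Cons v vs')
      have "ennreal (dist (\<gamma> u) (\<gamma> v)) \<le> ennreal (dist (\<gamma> u) (\<gamma> t)) + ennreal (dist (\<gamma> t) (\<gamma> v))"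
        by (simp add: dist_triangle flip: ennreal_plus)
      with Nil Cons show ?thesis
        by (simp add: add_right_mono flip: add.assoc)
    qed (simp add: Nil)
  next
    case (Cons u' us')
    with Cons.IH show ?thesis
      by (simp add: add_left_mono add.assoc)
  qed
qed

text \<open>The edge bounds \<open>L * (t - s)\<close> telescope along the sorted list. The left end
  \<open>c\<close> varies in the induction: the tail is bounded on the interval that starts at its
  own first parameter.\<close>

lemma polygon_length_le_lipschitz:
  assumes "L-lipschitz_on {a..b} \<gamma>" "sorted ts" "set ts \<subseteq> {c..d}" "a \<le> c" "c \<le> d" "d \<le> b"
  shows "polygon_length \<gamma> ts \<le> ennreal (L * (d - c))"
  using assms(2-6)
proof (induction ts arbitrary: c)
  case (Cons s ts)
  have L: "0 \<le> L"
    using assms(1) by (rule lipschitz_on_nonneg)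
  show ?case
  proof (cases ts)
    case (Cons t ts')
    have "polygon_length \<gamma> ts \<le> ennreal (L * (d - t))"
      using Cons.IH[of t] Cons.prems Cons by (auto simp: subset_iff)
    moreover have "dist (\<gamma> s) (\<gamma> t) \<le> L * (t - s)"
      using lipschitz_onD[OF assms(1), of s t] Cons.prems Cons by (auto simp: dist_real_def)
    ultimately have "polygon_length \<gamma> (s # ts) \<le> ennreal (L * (t - s)) + ennreal (L * (d - t))"
      using Cons by (auto intro!: add_mono ennreal_leI)
    also have "\<dots> = ennreal (L * (d - s))"
      using Cons.prems Cons L by (subst ennreal_plus[symmetric]) (auto simp: algebra_simps mult_left_mono)
    also have "\<dots> \<le> ennreal (L * (d - c))"
      using Cons.prems L by (intro ennreal_leI mult_left_mono) auto
    finally show ?thesis .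
  qed simp
qed simp

lemma curve_length_le_lipschitz:
  assumes "L-lipschitz_on {a..b} \<gamma>" "a \<le> c" "c \<le> d" "d \<le> b"
  shows "curve_length c d \<gamma> \<le> ennreal (L * (d - c))"
  unfolding curve_length_eq_SUP_polygon_length
  using assms by (auto intro!: SUP_least polygon_length_le_lipschitz)

lemma lipschitz_on_imp_locally_rectifiable:
  "L-lipschitz_on {a..b} \<gamma> \<Longrightarrow> locally_rectifiable a b \<gamma>"
  unfolding locally_rectifiable_def
  by (auto intro: le_less_trans[OF curve_length_le_lipschitz])

lemma curve_length_mono: "c \<le> d \<Longrightarrow> curve_length a c \<gamma> \<le> curve_length a d \<gamma>"
  unfolding curve_length_eq_SUP_polygon_length by (rule SUP_subset_mono) auto

text \<open>An inscribed polygon over \<open>{a..d}\<close> is cut at \<open>c\<close>: the part up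
  to \<open>c\<close> is inscribed over \<open>{a..c}\<close>, and the remainder is controlled by
  the Lipschitz bound.\<close>

lemma curve_length_le_add_lipschitz:
  assumes "L-lipschitz_on {a..b} \<gamma>" "a \<le> c" "c \<le> d" "d \<le> b"
  shows "curve_length a d \<gamma> \<le> curve_length a c \<gamma> + ennreal (L * (d - c))"
  unfolding curve_length_eq_SUP_polygon_length[of a d]
proof (rule SUP_least)
  fix ts assume "ts \<in> {ts. sorted ts \<and> set ts \<subseteq> {a..d}}"
  then have ts: "sorted ts" "set ts \<subseteq> {a..d}" by auto
  define us where "us = filter (\<lambda>t. t \<le> c) ts"
  define vs where "vs = filter (\<lambda>t. \<not> t \<le> c) ts"
  \<comment> \<open>Sortedness makes the two filtered lists a prefix and a suffix.\<close>
  have "ts = us @ vs"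
    using ts(1) unfolding us_def vs_def
  proof (induction ts)
    case (Cons t ts)
    have "filter (\<lambda>t. t \<le> c) ts = []" if "\<not> t \<le> c"
      using that Cons.prems by (intro filter_False) auto
    with Cons show ?case by auto
  qed simp
  moreover have "polygon_length \<gamma> (us @ [c]) \<le> curve_length a c \<gamma>"
    using ts assms by (intro polygon_length_le_curve_length)
      (auto simp: us_def sorted_append sorted_wrt_filter)
  moreover have "polygon_length \<gamma> (c # vs) \<le> ennreal (L * (d - c))"
    using ts assms by (intro polygon_length_le_lipschitz[OF assms(1)])
      (auto simp: vs_def sorted_wrt_filter)
  ultimately show "polygon_length \<gamma> ts \<le> curve_length a c \<gamma> + ennreal (L * (d - c))"
    using polygon_length_split[of \<gamma> us vs c] by (meson add_mono order_trans)
qed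

text \<open>These facts allow arc length to be inverted: a right inverse of a monotone
  \<open>L\<close>-Lipschitz function expands distances by a factor of at least
  \<open>1 / L\<close>.\<close>

lemma curve_length_function_lipschitz:
  fixes \<gamma> :: "real \<Rightarrow> 'a::metric_space"
  assumes "L-lipschitz_on {a..b} \<gamma>"
  shows "L-lipschitz_on {a..b} (\<lambda>t. enn2real (curve_length a t \<gamma>))"
    and "mono_on {a..b} (\<lambda>t. enn2real (curve_length a t \<gamma>))"
proof -
  have L: "0 \<le> L"
    using assms by (rule lipschitz_on_nonneg)
  \<comment> \<open>\<open>enn2real\<close> sends \<open>top\<close> to 0, so finiteness must be
    known before inequalities pass to real values.\<close>
  have fin: "curve_length a t \<gamma> < top" if "t \<in> {a..b}" for t
    using curve_length_le_lipschitz[OF assms, of a t] that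
    by (auto intro: le_less_trans)
  have mono: "enn2real (curve_length a s \<gamma>) \<le> enn2real (curve_length a t \<gamma>)"
    if "t \<in> {a..b}" "s \<le> t" for s t
    using fin that by (intro enn2real_mono curve_length_mono) auto
  then show "mono_on {a..b} (\<lambda>t. enn2real (curve_length a t \<gamma>))"
    by (auto intro!: mono_onI)
  show "L-lipschitz_on {a..b} (\<lambda>t. enn2real (curve_length a t \<gamma>))"
  proof (rule lipschitz_on_leI)
    fix s t assume st: "s \<in> {a..b}" "t \<in> {a..b}" "s \<le> t"
    have "enn2real (curve_length a t \<gamma>) \<le> enn2real (curve_length a s \<gamma> + ennreal (L * (t - s)))"
      using fin st curve_length_le_add_lipschitz[OF assms, of s t]
      by (intro enn2real_mono) (auto simp: ennreal_add_eq_top less_top)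
    also have "\<dots> = enn2real (curve_length a s \<gamma>) + L * (t - s)"
      using fin st L by (subst enn2real_plus) auto
    finally show "dist (enn2real (curve_length a s \<gamma>)) (enn2real (curve_length a t \<gamma>)) \<le> L * dist s t"
      using st mono by (simp add: dist_real_def)
  qed (rule L)
qed

section \<open>Arc length integrals along Lipschitz paths\<close>

text \<open>The push-forward of Lebesgue measure under an expanding map is at most \<open>L\<close> times Lebesgue
  measure: this is clear on intervals, passes to open sets by way of their components, and to
  Borel sets by outer regularity.\<close>

lemma nn_integral_expanding_le:
  fixes \<tau> :: "real \<Rightarrow> real"
  assumes [measurable]: "g \<in> borel_measurable borel" "S \<in> sets borel"
    and expand: "\<And>s t. s \<in> S \<Longrightarrow> t \<in> S \<Longrightarrow> s \<le> t \<Longrightarrow> t - s \<le> L * (\<tau> t - \<tau> s)"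
    and L: "0 < L"
  shows "(\<integral>\<^sup>+s\<in>S. g (\<tau> s) \<partial>lborel) \<le> ennreal L * (\<integral>\<^sup>+t. g t \<partial>lborel)"
proof -
  have "mono_on S \<tau>"
  proof (rule mono_onI)
    fix s t assume "s \<in> S" "t \<in> S" "s \<le> t"
    with expand[of s t] have "0 \<le> L * (\<tau> t - \<tau> s)"
      by linarith
    with L show "\<tau> s \<le> \<tau> t"
      by (simp add: zero_le_mult_iff)
  qed
  from borel_measurable_mono_on_fnc[OF this]
  have \<tau>[measurable]: "\<tau> \<in> borel_measurable (restrict_space lborel S)"
    by (simp cong: measurable_cong_sets add: sets_restrict_space)
  define \<mu> where "\<mu> = distr (restrict_space lborel S) borel \<tau>"
  have sets_\<mu>[measurable_cong, simp]: "sets \<mu> = sets borel"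
    by (simp add: \<mu>_def)
  have em: "emeasure \<mu> B = emeasure lborel {s \<in> S. \<tau> s \<in> B}" if "B \<in> sets borel" for B
  proof -
    have "\<tau> -` B \<inter> S = {s \<in> S. \<tau> s \<in> B}" by auto
    with that show ?thesis
      unfolding \<mu>_def
      by (subst emeasure_distr) (auto simp: emeasure_restrict_space space_restrict_space)
  qed
  \<comment> \<open>A component of an open subset of the line is an open interval. Points of
    \<open>S\<close> that \<tau> sends into it differ by at most \<open>L\<close> times its length,
    so they all lie in one interval of length \<open>L\<close> times that of the component.\<close>
  have interval: "emeasure \<mu> C \<le> ennreal L * emeasure lborel C" if "C \<in> components U" "open U" for C U
  proof (cases "emeasure lborel C = top")
    case True
    with L show ?thesis by (simp add: ennreal_mult_top)
  next
    case False
    have C: "open C" "connected C" "C \<noteq> {}"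
      using that by (auto simp: open_components in_components_connected in_components_nonempty)
    then have ab: "{u..v} \<subseteq> C" if "u \<in> C" "v \<in> C" for u v
      using that by (simp add: connected_contains_Icc)
    define T where "T = {s \<in> S. \<tau> s \<in> C}"
    define m where "m = enn2real (emeasure lborel C)"
    have m: "emeasure lborel C = ennreal m"
      using False by (simp add: m_def less_top)
    have m0: "0 \<le> m" by (simp add: m_def)
    have T: "t - s \<le> L * m" if "s \<in> T" "t \<in> T" for s t
    proof (cases "s \<le> t")
      case True
      have "\<tau> s \<le> \<tau> t"
        using \<open>mono_on S \<tau>\<close> that True by (auto simp: T_def mono_on_def)
      have "ennreal (\<tau> t - \<tau> s) \<le> emeasure lborel C"
        using emeasure_mono[OF ab[of "\<tau> s" "\<tau> t"], of lborel] that C \<open>\<tau> s \<le> \<tau> t\<close> by (auto simp: T_def)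
      then have "\<tau> t - \<tau> s \<le> m"
        by (simp add: m m0)
      then have "L * (\<tau> t - \<tau> s) \<le> L * m"
        using L by simp
      then show ?thesis
        using expand[of s t] that True by (auto simp: T_def)
    next
      case False
      moreover have "0 \<le> L * m"
        using L by (simp add: m0)
      ultimately show ?thesis by linarith
    qed
    have "emeasure lborel T \<le> ennreal (L * m)"
    proof (cases "T = {}")
      case False
      then obtain t0 where t0: "t0 \<in> T" by auto
      have bdd: "bdd_below T"
        using T[OF _ t0] by (intro bdd_belowI[of _ "t0 - L * m"]) (auto simp: algebra_simps)
      have "T \<subseteq> {Inf T..Inf T + L * m}"
      proof
        fix t assume t: "t \<in> T"
        have "t - L * m \<le> Inf T"
          using t0 T[OF _ t] by (intro cInf_greatest) (auto simp: algebra_simps)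
        then show "t \<in> {Inf T..Inf T + L * m}"
          using bdd t by (auto intro: cInf_lower simp: algebra_simps)
      qed
      from emeasure_mono[OF this, of lborel] show ?thesis
        using L by (simp add: m0)
    qed simp
    then show ?thesis
      using C L by (subst em) (auto simp: T_def m m0 ennreal_mult)
  qed
  have op: "emeasure \<mu> U \<le> ennreal L * emeasure lborel U" if "open U" for U
  proof -
    have count: "countable (components U)"
      using pairwise_disjoint_components[of U] open_components[OF that]
      by (intro countable_disjoint_open_subsets) (auto simp: pairwise_def disjnt_def)
    have disj: "disjoint_family_on (\<lambda>C. C) (components U)"
      using pairwise_disjoint_components[of U] by (auto simp: disjoint_family_on_def pairwise_def)
    have "emeasure \<mu> U = emeasure \<mu> (\<Union>C\<in>components U. C)"
      by (simp add: Union_components[symmetric])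
    also have "\<dots> = (\<integral>\<^sup>+C. emeasure \<mu> C \<partial>count_space (components U))"
      using open_components[OF that] count disj
      by (intro emeasure_UN_countable) auto
    also have "\<dots> \<le> (\<integral>\<^sup>+C. ennreal L * emeasure lborel C \<partial>count_space (components U))"
      using interval that by (intro nn_integral_mono) auto
    also have "\<dots> = ennreal L * (\<integral>\<^sup>+C. emeasure lborel C \<partial>count_space (components U))"
      by (simp add: nn_integral_cmult)
    also have "(\<integral>\<^sup>+C. emeasure lborel C \<partial>count_space (components U)) = emeasure lborel (\<Union>C\<in>components U. C)"
      using open_components[OF that] count disj
      by (intro emeasure_UN_countable[symmetric]) auto
    finally show ?thesis
      by (simp add: Union_components[symmetric])
  qed
  have le: "emeasure \<mu> B \<le> ennreal L * emeasure lborel B" if B[measurable]: "B \<in> sets borel" for B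
  proof (rule ennreal_le_epsilon)
    fix e :: real assume "0 < e"
    \<comment> \<open>The slack \<open>e / L\<close> of the outer approximation becomes
      \<open>e\<close> after multiplication by \<open>L\<close>.\<close>
    with L obtain U where U: "open U" "B \<subseteq> U" "emeasure lborel (U - B) < ennreal (e / L)"
      using outer_regular_lborel[OF B, of "e / L"] by auto
    have [measurable]: "U \<in> sets borel"
      using U(1) by simp
    have "emeasure \<mu> B \<le> emeasure \<mu> U"
      using U by (intro emeasure_mono) auto
    also have "\<dots> \<le> ennreal L * emeasure lborel (B \<union> (U - B))"
      using op[OF U(1)] U(2) by (simp add: Un_absorb1)
    also have "\<dots> = ennreal L * (emeasure lborel B + emeasure lborel (U - B))"
      by (subst plus_emeasure) auto
    also have "\<dots> \<le> ennreal L * (emeasure lborel B + ennreal (e / L))"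
      using U(3) by (intro mult_left_mono add_left_mono) auto
    also have "\<dots> = ennreal L * emeasure lborel B + ennreal e"
      using L \<open>0 < e\<close> by (simp add: distrib_left flip: ennreal_mult)
    finally show "emeasure \<mu> B \<le> ennreal L * emeasure lborel B + ennreal e" .
  qed
  have "(\<integral>\<^sup>+s\<in>S. g (\<tau> s) \<partial>lborel) = (\<integral>\<^sup>+s. g (\<tau> s) \<partial>restrict_space lborel S)"
    by (simp add: nn_integral_restrict_space)
  also have "\<dots> = (\<integral>\<^sup>+t. g t \<partial>\<mu>)"
    unfolding \<mu>_def by (simp add: nn_integral_distr)
  also have "\<dots> \<le> (\<integral>\<^sup>+t. g t \<partial>scale_measure (ennreal L) lborel)"
  proof (rule nn_integral_mono_measure)
    show "\<mu> \<le> scale_measure (ennreal L) lborel"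
      using le by (subst le_measure) auto
  qed simp
  also have "\<dots> = ennreal L * (\<integral>\<^sup>+t. g t \<partial>lborel)"
    by (simp add: nn_integral_scale_measure)
  finally show ?thesis .
qed

text \<open>Arc length grows at rate at most \<open>L\<close> along the path. Formally, the right
  inverse \<tau> of the length function \<Lambda> satisfies the expansion hypothesis of
  \<open>nn_integral_expanding_le\<close>. All later estimates can thus work with integrals in the
  parameter instead of \<open>path_integral\<close>.\<close>

lemma path_integral_le_lipschitz:
  fixes \<gamma> :: "real \<Rightarrow> 'a::metric_space"
  assumes [measurable]: "\<rho> \<in> borel_measurable borel"
    and lip: "L-lipschitz_on {a..b} \<gamma>" and L: "0 < L" and ab: "a \<le> b"
  shows "path_integral a b \<gamma> \<rho> \<le> ennreal L * (\<integral>\<^sup>+t\<in>{a..b}. \<rho> (\<gamma> t) \<partial>lborel)"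
proof -
  define \<Lambda> where "\<Lambda> = (\<lambda>t. enn2real (curve_length a t \<gamma>))"
  define \<tau> where "\<tau> = inv_into {a..b} \<Lambda>"
  note \<Lambda> = curve_length_function_lipschitz[OF lip, folded \<Lambda>_def]
  have "\<Lambda> a = 0"
    using curve_length_le_lipschitz[OF lip, of a a] ab by (simp add: \<Lambda>_def)
  moreover have "0 \<le> \<Lambda> b" by (simp add: \<Lambda>_def)
  ultimately have onto: "s \<in> \<Lambda> ` {a..b}" if "s \<in> {0..\<Lambda> b}" for s
    using IVT'[of \<Lambda> a s b] lipschitz_on_continuous_on[OF \<Lambda>(1)] ab that by force
  have \<tau>: "\<tau> s \<in> {a..b}" "\<Lambda> (\<tau> s) = s" if "s \<in> {0..\<Lambda> b}" for s
    using inv_into_into[OF onto[OF that]] f_inv_into_f[OF onto[OF that]] by (simp_all add: \<tau>_def)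
  have cont: "continuous_on {a..b} \<gamma>"
    using lip by (rule lipschitz_on_continuous_on)
  \<comment> \<open>Clamping the parameter to \<open>{a..b}\<close> makes the integrand Borel on the
    whole line, since the values of \<gamma> outside are arbitrary.\<close>
  define g where "g = (\<lambda>t. \<rho> (\<gamma> (max a (min b t))))"
  have "continuous_on UNIV (\<lambda>t. \<gamma> (max a (min b t)))"
    using ab by (intro continuous_on_compose2[OF cont] continuous_intros) auto
  then have [measurable]: "(\<lambda>t. \<gamma> (max a (min b t))) \<in> borel_measurable borel"
    by (rule borel_measurable_continuous_onI)
  have g[measurable]: "g \<in> borel_measurable borel"
    unfolding g_def by measurable
  have expand: "t - s \<le> L * (\<tau> t - \<tau> s)" if "s \<in> {0..\<Lambda> b}" "t \<in> {0..\<Lambda> b}" "s \<le> t" for s t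
  proof (cases "\<tau> s \<le> \<tau> t")
    case True
    then show ?thesis
      using lipschitz_onD[OF \<Lambda>(1) \<tau>(1)[OF that(1)] \<tau>(1)[OF that(2)]] \<tau>(2) that
      by (simp add: dist_real_def)
  next
    case False
    \<comment> \<open>As \<Lambda> is monotone and \<tau> is a right inverse of it, a reversed order
      of the parameters forces \<open>s = t\<close>.\<close>
    then have "t \<le> s"
      using mono_onD[OF \<Lambda>(2) \<tau>(1)[OF that(2)] \<tau>(1)[OF that(1)]] \<tau>(2) that by simp
    with that have "s = t" by simp
    then show ?thesis by simp
  qed
  have \<Lambda>_b: "enn2real (curve_length a b \<gamma>) = \<Lambda> b"
    by (simp add: \<Lambda>_def)
  \<comment> \<open>\<tau> takes values in \<open>{a..b}\<close>, so the added indicator equals 1;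
    after the substitution it confines the integral to \<open>{a..b}\<close>.\<close>
  have "path_integral a b \<gamma> \<rho> = (\<integral>\<^sup>+s\<in>{0..\<Lambda> b}. g (\<tau> s) * indicator {a..b} (\<tau> s) \<partial>lborel)"
    unfolding path_integral_def arc_length_rep_def \<Lambda>_def[symmetric] \<tau>_def[symmetric] \<Lambda>_b
    using \<tau>(1) by (intro nn_integral_cong) (auto simp: g_def indicator_def)
  also have "\<dots> \<le> ennreal L * (\<integral>\<^sup>+t. g t * indicator {a..b} t \<partial>lborel)"
    by (rule nn_integral_expanding_le[OF _ _ expand L]) auto
  also have "(\<integral>\<^sup>+t. g t * indicator {a..b} t \<partial>lborel) = (\<integral>\<^sup>+t\<in>{a..b}. \<rho> (\<gamma> t) \<partial>lborel)"
    by (intro nn_integral_cong) (auto simp: g_def indicator_def min_def max_def)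
  finally show ?thesis .
qed

section \<open>Bounds for integrals of \<rho> by its p-energy\<close>

lemma measurable_ennreal_rpow [measurable (raw)]:
  assumes [measurable]: "f \<in> borel_measurable M"
  shows "(\<lambda>x. ennreal_rpow (f x) p) \<in> borel_measurable M"
  unfolding ennreal_rpow_def by measurable

text \<open>Either \<open>x\<close> is at most \<open>c\<close>, or it exceeds \<open>c\<close> and
  then \<open>c powr (p - 1)\<close> is at most \<open>x powr (p - 1)\<close>, so the second term
  alone dominates \<open>x\<close>.\<close>

lemma le_add_mult_ennreal_rpow:
  assumes "0 < c" "1 \<le> p"
  shows "x \<le> ennreal c + ennreal (c powr (1 - p)) * ennreal_rpow x p"
proof (cases x)
  case (real r)
  have "r \<le> c + c powr (1 - p) * r powr p"
  proof (cases "r \<le> c")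
    case False
    have "r powr 1 * c powr (p - 1) \<le> r powr 1 * r powr (p - 1)"
      using False assms by (intro mult_left_mono powr_mono2) auto
    also have "\<dots> = r powr p"
      by (simp only: powr_add[symmetric]) simp
    finally have "c powr (1 - p) * (r * c powr (p - 1)) \<le> c powr (1 - p) * r powr p"
      using False assms by (intro mult_left_mono) auto
    moreover have "c powr (1 - p) * c powr (p - 1) = 1"
      using assms by (simp flip: powr_add)
    ultimately show ?thesis
      using assms by (simp add: mult.left_commute)
  qed (simp add: add_increasing2)
  with assms real show ?thesis
    by (simp add: ennreal_rpow_def flip: ennreal_mult ennreal_plus)
next
  case top
  with assms show ?thesis
    by (simp add: ennreal_rpow_def ennreal_mult_top)
qed

text \<open>With \<open>c\<close> chosen suitably, this replaces Hoelder's inequality.\<close>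

lemma set_nn_integral_le_rpow:
  fixes \<rho> :: "'a \<Rightarrow> ennreal"
  assumes [measurable]: "\<rho> \<in> borel_measurable M" "B \<in> sets M" and "0 < c" "1 \<le> p"
  shows "(\<integral>\<^sup>+x\<in>B. \<rho> x \<partial>M) \<le>
    ennreal c * emeasure M B + ennreal (c powr (1 - p)) * (\<integral>\<^sup>+x\<in>B. ennreal_rpow (\<rho> x) p \<partial>M)"
proof -
  have "(\<integral>\<^sup>+x\<in>B. \<rho> x \<partial>M) \<le>
      (\<integral>\<^sup>+x. ennreal c * indicator B x +
        ennreal (c powr (1 - p)) * (ennreal_rpow (\<rho> x) p * indicator B x) \<partial>M)"
    using le_add_mult_ennreal_rpow[OF assms(3,4)]
    by (intro nn_integral_mono) (auto simp: indicator_def)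
  also have "\<dots> = ennreal c * emeasure M B +
      ennreal (c powr (1 - p)) * (\<integral>\<^sup>+x\<in>B. ennreal_rpow (\<rho> x) p \<partial>M)"
    by (simp add: nn_integral_add nn_integral_cmult)
  finally show ?thesis .
qed

text \<open>The scaling is that of Hoelder's inequality: energy \<eta>^p s on a ball of volume of
  order s^n gives (\<eta>^p s)^(1/p) (s^n)^(1 - 1/p) = \<eta> s^(n - (n-1)/p). In the constant, the
  volume of the unit ball comes from the volume term and the summand 1 from the energy term.\<close>

lemma ball_nn_integral_le:
  fixes \<rho> :: "'a::euclidean_space \<Rightarrow> ennreal" and p :: real
  defines "\<kappa> \<equiv> (real DIM('a) - 1) / p"
  assumes [measurable]: "\<rho> \<in> borel_measurable borel"
    and "0 < \<eta>" "1 \<le> p" "0 < s"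
    and small: "(\<integral>\<^sup>+w\<in>ball x s. ennreal_rpow (\<rho> w) p \<partial>lborel) \<le> ennreal (\<eta> powr p * s)"
  shows "(\<integral>\<^sup>+w\<in>ball x s. \<rho> w \<partial>lborel) \<le>
    ennreal ((measure lborel (ball (0::'a) 1) + 1) * \<eta> * s powr (real DIM('a) - \<kappa>))"
proof -
  \<comment> \<open>this choice balances the two terms of \<open>set_nn_integral_le_rpow\<close>\<close>
  define c where "c = \<eta> * s powr (- \<kappa>)"
  define \<omega> where "\<omega> = measure lborel (ball (0::'a) 1)"
  have "0 < c"
    using assms by (simp add: c_def)
  have "0 \<le> \<omega>" by (simp add: \<omega>_def)
  have 1: "c * (s ^ DIM('a) * \<omega>) = \<omega> * \<eta> * s powr (real DIM('a) - \<kappa>)"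
    using \<open>0 < s\<close> by (simp add: c_def powr_diff powr_minus powr_realpow field_simps)
  have "\<kappa> * p = real DIM('a) - 1"
    using assms by (simp add: \<kappa>_def)
  then have e: "- \<kappa> * (1 - p) + 1 = real DIM('a) - \<kappa>"
    by (simp add: algebra_simps)
  have "c powr (1 - p) * (\<eta> powr p * s) =
      (\<eta> powr (1 - p) * \<eta> powr p) * (s powr (- \<kappa> * (1 - p)) * s powr 1)"
    using assms by (simp add: c_def powr_mult powr_powr)
  also have "\<dots> = \<eta> * s powr (real DIM('a) - \<kappa>)"
    using \<open>0 < \<eta>\<close> by (simp only: powr_add[symmetric] e) simp
  finally have 2: "c powr (1 - p) * (\<eta> powr p * s) = \<eta> * s powr (real DIM('a) - \<kappa>)" .
  have "(\<integral>\<^sup>+w\<in>ball x s. \<rho> w \<partial>lborel) \<le> ennreal c * emeasure lborel (ball x s) +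
      ennreal (c powr (1 - p)) * (\<integral>\<^sup>+w\<in>ball x s. ennreal_rpow (\<rho> w) p \<partial>lborel)"
    using \<open>0 < c\<close> \<open>1 \<le> p\<close> by (intro set_nn_integral_le_rpow) auto
  also have "\<dots> \<le> ennreal c * ennreal (s ^ DIM('a) * \<omega>) +
      ennreal (c powr (1 - p)) * ennreal (\<eta> powr p * s)"
    using \<open>0 < s\<close> content_ball_conv_unit_ball[of s x] emeasure_lborel_ball_finite[of x s]
    by (intro add_mono mult_left_mono small) (auto simp: emeasure_eq_ennreal_measure \<omega>_def)
  also have "\<dots> = ennreal (c * (s ^ DIM('a) * \<omega>) + c powr (1 - p) * (\<eta> powr p * s))"
    using \<open>0 < c\<close> \<open>0 < s\<close> \<open>0 < \<eta>\<close> \<open>0 \<le> \<omega>\<close> by (simp flip: ennreal_mult ennreal_plus)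
  also have "c * (s ^ DIM('a) * \<omega>) + c powr (1 - p) * (\<eta> powr p * s) =
      (\<omega> + 1) * \<eta> * s powr (real DIM('a) - \<kappa>)"
    unfolding 1 2 by (simp add: algebra_simps)
  finally show ?thesis by (simp add: \<omega>_def)
qed

section \<open>Averages of line integrals over random shifts\<close>

lemma set_nn_integral_ball_affine:
  fixes f :: "'a::euclidean_space \<Rightarrow> ennreal"
  assumes [measurable]: "f \<in> borel_measurable borel" and "0 < t"
  shows "(\<integral>\<^sup>+w\<in>ball z (t * r). f w \<partial>lborel) =
    ennreal (t ^ DIM('a)) * (\<integral>\<^sup>+u\<in>ball 0 r. f (z + t *\<^sub>R u) \<partial>lborel)"
proof -
  have [measurable]: "ball z (t * r) \<in> sets borel" "ball (0::'a) r \<in> sets borel"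
    by simp_all
  have "z + t *\<^sub>R u \<in> ball z (t * r) \<longleftrightarrow> u \<in> ball 0 r" for u :: 'a
    using \<open>0 < t\<close> by (simp add: dist_norm)
  then have "indicator (ball z (t * r)) (z + t *\<^sub>R u) = (indicator (ball 0 r) u :: ennreal)" for u
    by (simp add: indicator_def)
  then show ?thesis
    using \<open>0 < t\<close>
    by (subst lborel_affine[of t z], simp, subst nn_integral_density)
      (simp_all add: nn_integral_distr nn_integral_cmult)
qed

lemma nn_integral_powr_from_0:
  fixes k :: real
  assumes "k < 1"
  shows "(\<integral>\<^sup>+t\<in>{0..1}. ennreal (t powr (- k)) \<partial>lborel) = ennreal (1 / (1 - k))"
  using nn_integral_has_integral_lebesgue'[OF _ has_integral_powr_from_0[of "- k" 1]] assms
  by simp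

text \<open>By Fubini the average over \<open>u\<close> is taken first, for fixed \<open>t\<close>.
  The points at time \<open>t\<close> then sweep out a ball of radius \<open>t * r\<close>, and
  dividing the ball estimate by the Jacobian \<open>t ^ DIM('a)\<close> leaves
  \<open>t powr (- \<kappa>)\<close>. This is integrable at 0 because p > n - 1 means \<kappa> <
  1.\<close>

lemma average_segments_le:
  fixes \<rho> :: "'a::euclidean_space \<Rightarrow> ennreal" and p :: real
  defines "\<kappa> \<equiv> (real DIM('a) - 1) / p"
  assumes [measurable]: "\<rho> \<in> borel_measurable borel"
    and "0 < \<eta>" "1 \<le> p" "real DIM('a) - 1 < p" "0 < r" "dist x a \<le> r"
    and small: "\<And>s. 0 < s \<Longrightarrow> s \<le> 2 * r \<Longrightarrow>
      (\<integral>\<^sup>+w\<in>ball x s. ennreal_rpow (\<rho> w) p \<partial>lborel) \<le> ennreal (\<eta> powr p * s)"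
  shows "(\<integral>\<^sup>+u\<in>ball 0 r. (\<integral>\<^sup>+t\<in>{0..1}. \<rho> (x + t *\<^sub>R (a + u - x)) \<partial>lborel) \<partial>lborel) \<le>
    ennreal ((measure lborel (ball (0::'a) 1) + 1) * (2 * r) powr (real DIM('a) - \<kappa>) / (1 - \<kappa>) * \<eta>)"
proof -
  define C where "C = (measure lborel (ball (0::'a) 1) + 1) * \<eta> * (2 * r) powr (real DIM('a) - \<kappa>)"
  have "0 \<le> C" using \<open>0 < \<eta>\<close> by (simp add: C_def)
  have "\<kappa> < 1" using assms by (simp add: \<kappa>_def)
  have [measurable]: "ball (0::'a) r \<in> sets borel"
    by simp
  have slice: "(\<integral>\<^sup>+u\<in>ball 0 r. \<rho> (x + t *\<^sub>R (a + u - x)) \<partial>lborel) \<le> ennreal C * ennreal (t powr (- \<kappa>))"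
    if "0 < t" "t \<le> 1" for t
  proof -
    define z where "z = x + t *\<^sub>R (a - x)"
    have "t * dist x a \<le> t * r"
      using assms that by (intro mult_left_mono) auto
    moreover have "dist x z = t * dist x a"
      using that by (simp add: z_def dist_norm norm_minus_commute)
    \<comment> \<open>The centre \<open>z\<close> is within \<open>t * r\<close> of \<open>x\<close>
      and the radius is \<open>t * r\<close>; the sum of the two is why the energy hypothesis
      reaches up to radius \<open>2 * r\<close>.\<close>
    ultimately have "ball z (t * r) \<subseteq> ball x (2 * r * t)"
      by (subst ball_subset_ball_iff) (auto simp: dist_commute algebra_simps)
    then have "(\<integral>\<^sup>+w\<in>ball z (t * r). \<rho> w \<partial>lborel) \<le> (\<integral>\<^sup>+w\<in>ball x (2 * r * t). \<rho> w \<partial>lborel)"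
      by (intro nn_integral_mono) (auto simp: indicator_def)
    also have "\<dots> \<le> ennreal ((measure lborel (ball (0::'a) 1) + 1) * \<eta> * (2 * r * t) powr (real DIM('a) - \<kappa>))"
      unfolding \<kappa>_def using assms that by (intro ball_nn_integral_le small) auto
    also have "\<dots> = ennreal (t ^ DIM('a)) * (ennreal C * ennreal (t powr (- \<kappa>)))"
      using that \<open>0 < r\<close> \<open>0 \<le> C\<close>
      by (simp add: C_def powr_mult powr_diff powr_minus powr_realpow field_simps flip: ennreal_mult)
    finally have "ennreal (t ^ DIM('a)) * (\<integral>\<^sup>+u\<in>ball 0 r. \<rho> (z + t *\<^sub>R u) \<partial>lborel) \<le>
        ennreal (t ^ DIM('a)) * (ennreal C * ennreal (t powr (- \<kappa>)))"
      using that by (simp add: set_nn_integral_ball_affine)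
    then have "(\<integral>\<^sup>+u\<in>ball 0 r. \<rho> (z + t *\<^sub>R u) \<partial>lborel) \<le> ennreal C * ennreal (t powr (- \<kappa>))"
      using that by (subst (asm) ennreal_mult_le_mult_iff) auto
    then show ?thesis
      by (simp add: z_def algebra_simps)
  qed
  have "(\<integral>\<^sup>+u\<in>ball 0 r. (\<integral>\<^sup>+t\<in>{0..1}. \<rho> (x + t *\<^sub>R (a + u - x)) \<partial>lborel) \<partial>lborel) =
      (\<integral>\<^sup>+u. \<integral>\<^sup>+t. \<rho> (x + t *\<^sub>R (a + u - x)) * indicator {0..1} t * indicator (ball 0 r) u \<partial>lborel \<partial>lborel)"
    by (simp add: nn_integral_multc)
  also have "\<dots> = (\<integral>\<^sup>+t. \<integral>\<^sup>+u. \<rho> (x + t *\<^sub>R (a + u - x)) * indicator {0..1} t * indicator (ball 0 r) u \<partial>lborel \<partial>lborel)"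
    by (rule lborel_pair.Fubini') measurable
  also have "\<dots> = (\<integral>\<^sup>+t\<in>{0..1}. (\<integral>\<^sup>+u\<in>ball 0 r. \<rho> (x + t *\<^sub>R (a + u - x)) \<partial>lborel) \<partial>lborel)"
    by (subst nn_integral_multc[symmetric]) (auto simp: mult_ac)
  \<comment> \<open>At \<open>t = 0\<close> the swept ball degenerates to a point and
    \<open>slice\<close> says nothing; a single time is a null set.\<close>
  also have "\<dots> \<le> (\<integral>\<^sup>+t. ennreal C * (ennreal (t powr (- \<kappa>)) * indicator {0..1} t) \<partial>lborel)"
  proof (rule nn_integral_mono_AE)
    show "AE t in lborel. (\<integral>\<^sup>+u\<in>ball 0 r. \<rho> (x + t *\<^sub>R (a + u - x)) \<partial>lborel) * indicator {0..1} t
        \<le> ennreal C * (ennreal (t powr (- \<kappa>)) * indicator {0..1} t)"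
      using AE_lborel_singleton[of "0::real"]
      by eventually_elim (use slice in \<open>auto simp: indicator_def\<close>)
  qed
  also have "\<dots> = ennreal C * ennreal (1 / (1 - \<kappa>))"
    using \<open>\<kappa> < 1\<close> by (simp add: nn_integral_cmult nn_integral_powr_from_0)
  also have "\<dots> = ennreal (C / (1 - \<kappa>))"
    using \<open>\<kappa> < 1\<close> \<open>0 \<le> C\<close> by (simp flip: ennreal_mult)
  finally show ?thesis
    by (simp add: C_def mult_ac)
qed

text \<open>At each time \<open>t\<close> the translates fill a ball of the fixed radius
  \<open>r\<close>, so a bound on the total energy suffices, uniformly in \<open>t\<close>.\<close>

lemma average_translates_le:
  fixes \<rho> :: "'a::euclidean_space \<Rightarrow> ennreal" and g :: "real \<Rightarrow> 'a"
  assumes [measurable]: "\<rho> \<in> borel_measurable borel" "g \<in> borel_measurable borel"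
    and "0 < \<eta>" "1 \<le> p" "0 < r" "0 \<le> c"
    and E: "(\<integral>\<^sup>+w. ennreal_rpow (\<rho> w) p \<partial>lborel) \<le> ennreal (\<eta> powr p * c)"
  shows "(\<integral>\<^sup>+u\<in>ball 0 r. (\<integral>\<^sup>+t\<in>{0..1}. \<rho> (g t + u) \<partial>lborel) \<partial>lborel) \<le>
    ennreal ((measure lborel (ball (0::'a) r) + c) * \<eta>)"
proof -
  have [measurable]: "ball (0::'a) r \<in> sets borel"
    by simp
  have slice: "(\<integral>\<^sup>+u\<in>ball 0 r. \<rho> (g t + u) \<partial>lborel) \<le> ennreal ((measure lborel (ball (0::'a) r) + c) * \<eta>)" for t
  proof -
    have "(\<integral>\<^sup>+u\<in>ball 0 r. \<rho> (g t + u) \<partial>lborel) = (\<integral>\<^sup>+w\<in>ball (g t) r. \<rho> w \<partial>lborel)"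
      using set_nn_integral_ball_affine[of \<rho> 1 "g t" r] by simp
    \<comment> \<open>Cutting \<rho> at the level \<eta> makes both terms proportional to
      \<eta>.\<close>
    also have "\<dots> \<le> ennreal \<eta> * emeasure lborel (ball (g t) r) +
        ennreal (\<eta> powr (1 - p)) * (\<integral>\<^sup>+w\<in>ball (g t) r. ennreal_rpow (\<rho> w) p \<partial>lborel)"
      using assms by (intro set_nn_integral_le_rpow) auto
    also have "\<dots> \<le> ennreal \<eta> * ennreal (measure lborel (ball (0::'a) r)) +
        ennreal (\<eta> powr (1 - p)) * ennreal (\<eta> powr p * c)"
      using content_ball_conv_unit_ball[of r "g t"] content_ball_conv_unit_ball[of r "0::'a"]
        emeasure_lborel_ball_finite[of "g t" r] \<open>0 < r\<close>
      by (intro add_mono mult_left_mono order_trans[OF _ E] nn_integral_mono)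
        (auto simp: emeasure_eq_ennreal_measure indicator_def)
    also have "\<dots> = ennreal (\<eta> * measure lborel (ball (0::'a) r) + (\<eta> powr (1 - p) * \<eta> powr p) * c)"
      using \<open>0 \<le> c\<close> \<open>0 < \<eta>\<close> by (simp add: mult.assoc flip: ennreal_mult ennreal_plus)
    also have "\<eta> powr (1 - p) * \<eta> powr p = \<eta>"
      using \<open>0 < \<eta>\<close> by (simp flip: powr_add)
    finally show ?thesis by (simp add: algebra_simps)
  qed
  have "(\<integral>\<^sup>+u\<in>ball 0 r. (\<integral>\<^sup>+t\<in>{0..1}. \<rho> (g t + u) \<partial>lborel) \<partial>lborel) =
      (\<integral>\<^sup>+u. \<integral>\<^sup>+t. \<rho> (g t + u) * indicator {0..1} t * indicator (ball 0 r) u \<partial>lborel \<partial>lborel)"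
    by (simp add: nn_integral_multc)
  also have "\<dots> = (\<integral>\<^sup>+t. \<integral>\<^sup>+u. \<rho> (g t + u) * indicator {0..1} t * indicator (ball 0 r) u \<partial>lborel \<partial>lborel)"
    by (rule lborel_pair.Fubini') measurable
  also have "\<dots> = (\<integral>\<^sup>+t\<in>{0..1}. (\<integral>\<^sup>+u\<in>ball 0 r. \<rho> (g t + u) \<partial>lborel) \<partial>lborel)"
    by (subst nn_integral_multc[symmetric]) (auto simp: mult_ac)
  also have "\<dots> \<le> (\<integral>\<^sup>+t\<in>{0..1}. ennreal ((measure lborel (ball (0::'a) r) + c) * \<eta>) \<partial>(lborel :: real measure))"
    using slice by (intro nn_integral_mono mult_right_mono) auto
  also have "\<dots> = ennreal ((measure lborel (ball (0::'a) r) + c) * \<eta>)"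
    by (simp add: nn_integral_cmult_indicator)
  finally show ?thesis .
qed

section \<open>Points of small energy density on a connected set\<close>

text \<open>If every point of \<open>K\<close> within \<open>r\<close> of \<open>a\<close> were the
  centre of a ball of radius s and mass above c s, disjoint balls of this kind would have fivefold
  enlargements covering these points. Their images under \<open>dist a\<close> lie in intervals of
  length 10 s that cover \<open>{0..r}\<close>, so \<open>c * r\<close> would be at most 10 times
  the total mass. The 10 is 5 from Vitali times 2 from radius to length.\<close>

lemma exists_small_density_point:
  fixes M :: "'a::euclidean_space measure"
  assumes [measurable_cong]: "sets M = sets borel"
    and K: "connected K" "a \<in> K" "b \<in> K" and r: "0 < r" "r \<le> dist a b"
    and c: "0 \<le> c" and small: "10 * emeasure M UNIV < ennreal (c * r)"
  obtains x where "x \<in> K" "dist a x \<le> r" "\<And>s. 0 < s \<Longrightarrow> s \<le> R \<Longrightarrow> emeasure M (ball x s) \<le> ennreal (c * s)"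
proof (rule ccontr)
  assume "\<not> thesis"
  with that have "\<forall>x\<in>K \<inter> cball a r. \<exists>s. 0 < s \<and> s \<le> R \<and> ennreal (c * s) < emeasure M (ball x s)"
    by (metis IntD1 IntD2 mem_cball not_le)
  then obtain s where s: "\<And>x. x \<in> K \<inter> cball a r \<Longrightarrow> 0 < s x \<and> s x \<le> R"
      "\<And>x. x \<in> K \<inter> cball a r \<Longrightarrow> ennreal (c * s x) < emeasure M (ball x (s x))"
    by metis
  have "K \<inter> cball a r \<subseteq> (\<Union>x\<in>K \<inter> cball a r. ball x (s x))"
    using s(1) by auto
  then obtain C where C: "C \<subseteq> K \<inter> cball a r"
      "pairwise (\<lambda>i j. disjnt (ball i (s i)) (ball j (s j))) C"
      "K \<inter> cball a r \<subseteq> (\<Union>x\<in>C. ball x (5 * s x))"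
    using s(1) by (rule Vitali_covering_lemma_balls[where a = "\<lambda>x. x"])
  \<comment> \<open>Connectedness enters here: \<open>dist a\<close> takes on \<open>K\<close> every
    value between 0 and \<open>dist a b\<close>, hence every value up to \<open>r\<close>, and a
    point with such a value lies in \<open>cball a r\<close>.\<close>
  have "{0..r} \<subseteq> (\<Union>x\<in>C. ball (dist a x) (5 * s x))"
  proof
    fix d assume d: "d \<in> {0..r}"
    have "connected (dist a ` K)"
      using K(1) by (intro connected_continuous_image continuous_intros)
    then have "{dist a a..dist a b} \<subseteq> dist a ` K"
      using K by (intro connected_contains_Icc) auto
    with d r obtain z where z: "z \<in> K" "d = dist a z"
      by (auto simp: subset_iff)
    with C(3) d obtain x where "x \<in> C" "dist x z < 5 * s x"
      by (auto simp: subset_iff)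
    moreover have "dist (dist a x) d \<le> dist x z"
      using dist_triangle[of a x z] dist_triangle[of a z x] z(2)
      by (simp add: dist_real_def abs_le_iff dist_commute)
    ultimately show "d \<in> (\<Union>x\<in>C. ball (dist a x) (5 * s x))"
      by (auto intro!: bexI[of _ x])
  qed
  \<comment> \<open>Compactness of \<open>{0..r}\<close> reduces the Vitali family to a finite one,
    so that only finite sums occur.\<close>
  then obtain F where F: "F \<subseteq> C" "finite F" "{0..r} \<subseteq> (\<Union>x\<in>F. ball (dist a x) (5 * s x))"
    by (rule compactE_image[OF compact_Icc, rotated]) auto
  have pos: "0 < s x" if "x \<in> F" for x
    using that F C s(1) by blast
  have ball_le: "ennreal (c * s x) \<le> emeasure M (ball x (s x))" if "x \<in> F" for x
    using that F(1) C(1) s(2)[of x] by (blast intro: less_imp_le)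
  have "ennreal r = emeasure lborel {0..r}"
    using r by simp
  also have "\<dots> \<le> emeasure lborel (\<Union>x\<in>F. ball (dist a x) (5 * s x))"
    using F(2) by (intro emeasure_mono F(3)) auto
  also have "\<dots> \<le> (\<Sum>x\<in>F. emeasure lborel (ball (dist a x) (5 * s x)))"
    by (rule emeasure_subadditive_finite) (use F in auto)
  also have "\<dots> = (\<Sum>x\<in>F. ennreal (10 * s x))"
    using pos by (intro sum.cong) (auto simp: ball_eq_greaterThanLessThan less_imp_le)
  finally have "ennreal c * ennreal r \<le> ennreal c * (\<Sum>x\<in>F. ennreal (10 * s x))"
    by (rule mult_left_mono) simp
  also have "\<dots> = 10 * (\<Sum>x\<in>F. ennreal (c * s x))"
    using c pos by (auto simp: sum_distrib_left ennreal_mult' less_imp_le mult_ac intro!: sum.cong)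
  also have "\<dots> \<le> 10 * (\<Sum>x\<in>F. emeasure M (ball x (s x)))"
    by (intro mult_left_mono sum_mono ball_le) auto
  also have "(\<Sum>x\<in>F. emeasure M (ball x (s x))) = emeasure M (\<Union>x\<in>F. ball x (s x))"
    using F(2) pairwise_subset[OF C(2) F(1)]
    by (intro sum_emeasure) (simp_all add: disjoint_family_on_def pairwise_def disjnt_def assms(1) image_subset_iff)
  also have "\<dots> \<le> emeasure M UNIV"
    by (intro emeasure_mono) (auto simp: assms(1))
  finally have "ennreal (c * r) \<le> 10 * emeasure M UNIV"
    using c r by (simp add: ennreal_mult mult_left_mono)
  with small show False by simp
qed

section \<open>Paths made of two segments and a translated curve\<close>

lemma polynomial_function_lipschitz_on_compact:
  fixes g :: "real \<Rightarrow> 'a::euclidean_space"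
  assumes "polynomial_function g"
  obtains B where "B-lipschitz_on {a..b} g"
proof -
  from assms obtain g' where g': "polynomial_function g'" "\<And>t. (g has_vector_derivative g' t) (at t)"
    using has_vector_derivative_polynomial_function by blast
  have "bounded (g' ` {a..b})"
    using g'(1) by (intro compact_imp_bounded compact_continuous_image continuous_on_polymonial_function compact_Icc)
  then obtain B where B: "0 < B" "\<And>t. t \<in> {a..b} \<Longrightarrow> norm (g' t) \<le> B"
    unfolding bounded_pos by auto
  have "B-lipschitz_on {a..b} g"
  proof (rule bounded_derivative_imp_lipschitz)
    show "(g has_derivative (\<lambda>h. h *\<^sub>R g' t)) (at t within {a..b})" for t
      using g'(2)[of t] by (simp add: has_vector_derivative_def has_derivative_at_withinI)
    show "onorm (\<lambda>h. h *\<^sub>R g' t) \<le> B" if "t \<in> {a..b}" for t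
      using B(2)[OF that] by (intro onorm_le) (simp add: mult.commute[of B] mult_left_mono)
  qed (use B in auto)
  then show ?thesis by (rule that)
qed

text \<open>The three pieces are concatenated over \<open>{0..3}\<close> into one
  \<open>L\<close>-Lipschitz path from \<open>x\<close> to \<open>y\<close>. It is rectifiable, so
  admissibility applies, and \<open>path_integral_le_lipschitz\<close> turns the arc length integral
  into parameter integrals.\<close>

lemma adm_joining_paths_three_pieces:
  fixes g :: "real \<Rightarrow> 'a::euclidean_space"
  assumes \<rho>: "\<rho> \<in> adm (joining_paths A A' D)"
    and g: "L-lipschitz_on {0..1} g" "continuous_on UNIV g" "g 0 = a" "g 1 = a'" and "0 < L"
    and xy: "x \<in> A" "y \<in> A'" "norm (a + u - x) \<le> L" "norm (a' + u - y) \<le> L"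
    and D: "\<And>t. t \<in> {0..1} \<Longrightarrow> x + t *\<^sub>R (a + u - x) \<in> D" "\<And>t. t \<in> {0..1} \<Longrightarrow> g t + u \<in> D"
      "\<And>t. t \<in> {0..1} \<Longrightarrow> y + t *\<^sub>R (a' + u - y) \<in> D"
  shows "1 \<le> ennreal L * ((\<integral>\<^sup>+t\<in>{0..1}. \<rho> (x + t *\<^sub>R (a + u - x)) \<partial>lborel) +
    (\<integral>\<^sup>+t\<in>{0..1}. \<rho> (g t + u) \<partial>lborel) + (\<integral>\<^sup>+t\<in>{0..1}. \<rho> (y + t *\<^sub>R (a' + u - y)) \<partial>lborel))"
proof -
  define f1 where "f1 = (\<lambda>t. x + t *\<^sub>R (a + u - x))"
  define f2 where "f2 = (\<lambda>t. g t + u)"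
  define f3 where "f3 = (\<lambda>t. y + t *\<^sub>R (a' + u - y))"
  \<comment> \<open>The last segment is traversed backwards, from \<open>a' + u\<close> to
    \<open>y\<close>, so that the pieces agree at times 1 and 2.\<close>
  define \<gamma> where "\<gamma> = (\<lambda>t. if t \<le> 1 then f1 t else if t \<le> 2 then f2 (t - 1) else f3 (3 - t))"
  have [measurable]: "\<rho> \<in> borel_measurable borel"
    using \<rho> by (simp add: adm_def)
  have [measurable]: "g \<in> borel_measurable borel"
    using g(2) by (rule borel_measurable_continuous_onI)
  have [measurable]: "f1 \<in> borel_measurable borel" "f2 \<in> borel_measurable borel" "f3 \<in> borel_measurable borel"
    unfolding f1_def f2_def f3_def by measurable
  have [measurable]: "\<gamma> \<in> borel_measurable borel"
    unfolding \<gamma>_def by measurable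
  have lip: "L-lipschitz_on {0..3} \<gamma>"
    unfolding \<gamma>_def
  proof (intro lipschitz_on_concat)
    show "L-lipschitz_on {0..1} f1"
    proof (rule lipschitz_onI)
      fix s t :: real
      have "dist (f1 s) (f1 t) = dist s t * norm (a + u - x)"
        by (simp add: f1_def dist_norm scaleR_diff_left[symmetric])
      also have "\<dots> \<le> L * dist s t"
        using xy(3) by (simp add: mult.commute[of L] mult_left_mono)
      finally show "dist (f1 s) (f1 t) \<le> L * dist s t" .
    qed (use \<open>0 < L\<close> in simp)
    show "L-lipschitz_on {1..2} (\<lambda>t. f2 (t - 1))"
    proof (rule lipschitz_onI)
      show "dist (f2 (s - 1)) (f2 (t - 1)) \<le> L * dist s t" if "s \<in> {1..2}" "t \<in> {1..2}" for s t
        using lipschitz_onD[OF g(1), of "s - 1" "t - 1"] that by (simp add: f2_def dist_norm)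
    qed (use \<open>0 < L\<close> in simp)
    show "L-lipschitz_on {2..3} (\<lambda>t. f3 (3 - t))"
    proof (rule lipschitz_onI)
      fix s t :: real
      have "dist (f3 (3 - s)) (f3 (3 - t)) = dist s t * norm (a' + u - y)"
        by (simp add: f3_def dist_norm scaleR_diff_left[symmetric] abs_minus_commute)
      also have "\<dots> \<le> L * dist s t"
        using xy(4) by (simp add: mult.commute[of L] mult_left_mono)
      finally show "dist (f3 (3 - s)) (f3 (3 - t)) \<le> L * dist s t" .
    qed (use \<open>0 < L\<close> in simp)
  qed (use g in \<open>auto simp: f1_def f2_def f3_def\<close>)
  have "(0, 3, \<gamma>) \<in> joining_paths A A' D"
    unfolding joining_paths_def using xy D lipschitz_on_continuous_on[OF lip]
    by (auto simp: \<gamma>_def f1_def f2_def f3_def)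
  with \<rho> have "1 \<le> path_integral 0 3 \<gamma> \<rho>"
    using lipschitz_on_imp_locally_rectifiable[OF lip] by (auto simp: adm_def)
  also have "\<dots> \<le> ennreal L * (\<integral>\<^sup>+t\<in>{0..3}. \<rho> (\<gamma> t) \<partial>lborel)"
    using lip \<open>0 < L\<close> by (intro path_integral_le_lipschitz) auto
  \<comment> \<open>At \<open>t = 1\<close> and \<open>t = 2\<close> two of the indicators equal 1,
    hence only an inequality pointwise.\<close>
  also have "(\<integral>\<^sup>+t\<in>{0..3}. \<rho> (\<gamma> t) \<partial>lborel) \<le> (\<integral>\<^sup>+t. \<rho> (f1 t) * indicator {0..1} t +
      \<rho> (f2 (t - 1)) * indicator {0..1} (t - 1) + \<rho> (f3 (3 - t)) * indicator {0..1} (3 - t) \<partial>lborel)"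
    by (intro nn_integral_mono) (auto simp: \<gamma>_def indicator_def)
  also have "\<dots> = (\<integral>\<^sup>+t\<in>{0..1}. \<rho> (f1 t) \<partial>lborel) +
      (\<integral>\<^sup>+t. \<rho> (f2 (t - 1)) * indicator {0..1} (t - 1) \<partial>lborel) +
      (\<integral>\<^sup>+t. \<rho> (f3 (3 - t)) * indicator {0..1} (3 - t) \<partial>lborel)"
    by (subst nn_integral_add; simp)+
  also have "(\<integral>\<^sup>+t. \<rho> (f2 (t - 1)) * indicator {0..1} (t - 1) \<partial>lborel) = (\<integral>\<^sup>+t\<in>{0..1}. \<rho> (f2 t) \<partial>lborel)"
    using nn_integral_real_affine[of "\<lambda>t. \<rho> (f2 t) * indicator {0..1} t" 1 "-1"] by simp
  also have "(\<integral>\<^sup>+t. \<rho> (f3 (3 - t)) * indicator {0..1} (3 - t) \<partial>lborel) = (\<integral>\<^sup>+t\<in>{0..1}. \<rho> (f3 t) \<partial>lborel)"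
    using nn_integral_real_affine[of "\<lambda>t. \<rho> (f3 t) * indicator {0..1} t" "-1" 3] by simp
  finally show ?thesis
    by (simp add: f1_def f2_def f3_def mult_left_mono)
qed

section \<open>A positive lower bound for the energy of all admissible functions\<close>

theorem modulus_joining_paths_pos:
  fixes D A A' :: "'a::euclidean_space set" and p :: real
  assumes "DIM('a) \<ge> 2" and D: "open D" "connected D" and p: "p > real DIM('a) - 1"
    and A: "nondegenerate_continuum A" "A \<subseteq> D" and A': "nondegenerate_continuum A'" "A' \<subseteq> D"
  shows "modulus p (joining_paths A A' D) > 0"
proof -
  have "1 \<le> p"
    using assms(1) p by simp
  have nonconst: "\<exists>a b. a \<in> B \<and> b \<in> B \<and> 0 < dist a b" "connected B"
    if "nondegenerate_continuum B" for B :: "'a set"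
    using that by (auto simp: nondegenerate_continuum_def)
  obtain a b a' b' where ab: "a \<in> A" "b \<in> A" "0 < dist a b" and ab': "a' \<in> A'" "b' \<in> A'" "0 < dist a' b'"
    using nonconst(1)[OF A(1)] nonconst(1)[OF A'(1)] by blast
  \<comment> \<open>A polynomial path is Lipschitz on \<open>{0..1}\<close> and continuous on the
    whole line, which gives the rectifiability and the measurability needed later.\<close>
  obtain g where g: "polynomial_function g" "path_image g \<subseteq> D" "pathstart g = a" "pathfinish g = a'"
    using connected_open_polynomial_connected[OF D, of a a'] ab ab' A A' by blast
  have "continuous_on UNIV g"
    using g(1) by (rule continuous_on_polymonial_function)
  then have [measurable]: "g \<in> borel_measurable borel"
    by (rule borel_measurable_continuous_onI)
  obtain B where B: "B-lipschitz_on {0..1} g"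
    using polynomial_function_lipschitz_on_compact[OF g(1)] by blast
  have "compact (path_image g)"
    using g(1) by (simp add: compact_path_image path_polynomial_function)
  then obtain e where e: "0 < e" "(\<Union>z\<in>path_image g. cball z e) \<subseteq> D"
    using compact_subset_open_imp_cball_epsilon_subset D(1) g(2) by metis
  define r where "r = min e (min (dist a b) (dist a' b'))"
  have r: "0 < r" "r \<le> dist a b" "r \<le> dist a' b'" "r \<le> e"
    using e ab ab' by (auto simp: r_def)
  have tube: "cball (g t) r \<subseteq> D" if "t \<in> {0..1}" for t
    using that e(2) r(4) by (force simp: path_image_def)
  have g01: "g 0 = a" "g 1 = a'"
    using g by (auto simp: pathstart_def pathfinish_def)
  \<comment> \<open>\<open>B\<close> serves the curve \<open>g\<close>; each of the two segments has
    length at most \<open>2 * r\<close>.\<close>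
  define L where "L = B + 2 * r"
  have L: "0 < L" "2 * r \<le> L" "L-lipschitz_on {0..1} g"
    using r lipschitz_on_nonneg[OF B] lipschitz_on_le[OF B, of L] by (auto simp: L_def)
  define \<kappa> where "\<kappa> = (real DIM('a) - 1) / p"
  have "\<kappa> < 1"
    using p assms(1) by (simp add: \<kappa>_def)
  define C\<^sub>1 where "C\<^sub>1 = (measure lborel (ball (0::'a) 1) + 1) * (2 * r) powr (real DIM('a) - \<kappa>) / (1 - \<kappa>)"
  define W where "W = measure lborel (ball (0::'a) r)"
  have "0 < W"
    using content_ball_pos[OF r(1)] by (simp add: W_def)
  have "0 \<le> C\<^sub>1"
    using \<open>\<kappa> < 1\<close> by (simp add: C\<^sub>1_def)
  define C where "C = 2 * C\<^sub>1 + (W + r)"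
  have "0 < C"
    using \<open>0 < W\<close> \<open>0 \<le> C\<^sub>1\<close> r by (simp add: C_def)
  \<comment> \<open>\<open>C * \<eta>\<close> will bound the sum of the three averages; this \<eta>
    makes \<open>L * (C * \<eta>)\<close> equal to \<open>W / 2\<close>, half the volume of the ball
    of shifts.\<close>
  define \<eta> where "\<eta> = W / (2 * L * C)"
  have "0 < \<eta>"
    using \<open>0 < W\<close> \<open>0 < C\<close> L by (simp add: \<eta>_def)
  \<comment> \<open>\<open>10 * m\<close> is half of \<open>\<eta> powr p * r\<close>, which yields
    the strict inequality required for the density points. No admissible function enters the choice
    of \<open>m\<close>.\<close>
  define m where "m = \<eta> powr p * r / 20"
  have "0 < m"
    using \<open>0 < \<eta>\<close> r by (simp add: m_def)
  have "ennreal m \<le> (\<integral>\<^sup>+x. ennreal_rpow (\<rho> x) p \<partial>lborel)" if \<rho>: "\<rho> \<in> adm (joining_paths A A' D)" for \<rho>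
  proof (rule ccontr)
    have [measurable]: "\<rho> \<in> borel_measurable borel"
      using \<rho> by (simp add: adm_def)
    have [measurable]: "ball (0::'a) r \<in> sets borel"
      by simp
    assume "\<not> ennreal m \<le> (\<integral>\<^sup>+x. ennreal_rpow (\<rho> x) p \<partial>lborel)"
    then have E: "(\<integral>\<^sup>+x. ennreal_rpow (\<rho> x) p \<partial>lborel) \<le> ennreal m"
      by simp
    \<comment> \<open>The energy of \<rho> as a measure, to which the density lemma applies; radii
      up to \<open>2 * r\<close> are what the segment averages need.\<close>
    define M where "M = density lborel (\<lambda>x. ennreal_rpow (\<rho> x) p)"
    have sets_M: "sets M = sets borel"
      by (simp add: M_def)
    have M: "emeasure M (ball x s) = (\<integral>\<^sup>+w\<in>ball x s. ennreal_rpow (\<rho> w) p \<partial>lborel)" for x s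
      by (simp add: M_def emeasure_density)
    have "10 * emeasure M UNIV \<le> 10 * ennreal m"
      using E by (intro mult_left_mono) (auto simp: M_def emeasure_density)
    also have "\<dots> = ennreal (10 * m)"
      using \<open>0 < m\<close> by (simp add: ennreal_mult)
    also have "\<dots> < ennreal (\<eta> powr p * r)"
      using \<open>0 < \<eta>\<close> r by (intro ennreal_lessI) (auto simp: m_def)
    finally have M_small: "10 * emeasure M UNIV < ennreal (\<eta> powr p * r)" .
    obtain x where x: "x \<in> A" "dist a x \<le> r"
        "\<And>s. 0 < s \<Longrightarrow> s \<le> 2 * r \<Longrightarrow> emeasure M (ball x s) \<le> ennreal (\<eta> powr p * s)"
      using exists_small_density_point[OF sets_M nonconst(2)[OF A(1)] ab(1,2) r(1,2) _ M_small, of "2 * r"]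
      by auto
    obtain y where y: "y \<in> A'" "dist a' y \<le> r"
        "\<And>s. 0 < s \<Longrightarrow> s \<le> 2 * r \<Longrightarrow> emeasure M (ball y s) \<le> ennreal (\<eta> powr p * s)"
      using exists_small_density_point[OF sets_M nonconst(2)[OF A'(1)] ab'(1,2) r(1,3) _ M_small, of "2 * r"]
      by auto
    define J\<^sub>1 where "J\<^sub>1 = (\<lambda>u. \<integral>\<^sup>+t\<in>{0..1}. \<rho> (x + t *\<^sub>R (a + u - x)) \<partial>lborel)"
    define J\<^sub>2 where "J\<^sub>2 = (\<lambda>u. \<integral>\<^sup>+t\<in>{0..1}. \<rho> (g t + u) \<partial>lborel)"
    define J\<^sub>3 where "J\<^sub>3 = (\<lambda>u. \<integral>\<^sup>+t\<in>{0..1}. \<rho> (y + t *\<^sub>R (a' + u - y)) \<partial>lborel)"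
    have [measurable]: "J\<^sub>1 \<in> borel_measurable borel" "J\<^sub>2 \<in> borel_measurable borel" "J\<^sub>3 \<in> borel_measurable borel"
      unfolding J\<^sub>1_def J\<^sub>2_def J\<^sub>3_def by measurable
    have avg1: "(\<integral>\<^sup>+u\<in>ball 0 r. J\<^sub>1 u \<partial>lborel) \<le> ennreal (C\<^sub>1 * \<eta>)"
      unfolding J\<^sub>1_def C\<^sub>1_def \<kappa>_def
      using x \<open>0 < \<eta>\<close> \<open>1 \<le> p\<close> p r by (intro average_segments_le) (auto simp: dist_commute M)
    have avg2: "(\<integral>\<^sup>+u\<in>ball 0 r. J\<^sub>2 u \<partial>lborel) \<le> ennreal ((W + r) * \<eta>)"
      unfolding J\<^sub>2_def W_def
    \<comment> \<open>The free constant of the lemma is taken to be \<open>r\<close>, since the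
      energy is at most \<open>m\<close> and so at most \<open>\<eta> powr p * r\<close>.\<close>
    proof (rule average_translates_le)
      show "(\<integral>\<^sup>+w. ennreal_rpow (\<rho> w) p \<partial>lborel) \<le> ennreal (\<eta> powr p * r)"
        using E by (rule order_trans) (use r in \<open>auto simp: m_def intro!: ennreal_leI\<close>)
    qed (use \<open>0 < \<eta>\<close> \<open>1 \<le> p\<close> r in auto)
    have avg3: "(\<integral>\<^sup>+u\<in>ball 0 r. J\<^sub>3 u \<partial>lborel) \<le> ennreal (C\<^sub>1 * \<eta>)"
      unfolding J\<^sub>3_def C\<^sub>1_def \<kappa>_def
      using y \<open>0 < \<eta>\<close> \<open>1 \<le> p\<close> p r by (intro average_segments_le) (auto simp: dist_commute M)
    have lower: "1 \<le> ennreal L * (J\<^sub>1 u + J\<^sub>2 u + J\<^sub>3 u)" if u: "u \<in> ball 0 r" for u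
    proof -
      \<comment> \<open>Used for \<open>a\<close>, \<open>x\<close> and for \<open>a'\<close>,
        \<open>y\<close>: both ends of the segment lie in the convex ball \<open>cball c r\<close>,
        which is part of the tube around \<open>g\<close>.\<close>
      have seg: "z + t *\<^sub>R (c + u - z) \<in> D"
        if "dist c z \<le> r" "cball c r \<subseteq> D" "t \<in> {0..1}" for c z t
      proof -
        have "(1 - t) *\<^sub>R z + t *\<^sub>R (c + u) \<in> cball c r"
          using that u by (intro convexD_alt) (auto simp: dist_norm)
        with that(2) show "z + t *\<^sub>R (c + u - z) \<in> D"
          by (auto simp: algebra_simps)
      qed
      have len: "norm (c + u - z) \<le> L" if "dist c z \<le> r" for c z
      proof -
        have "norm (c + u - z) \<le> norm (c - z) + norm u"
          by (metis add_diff_eq add.commute norm_triangle_ineq)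
        with that u L(2) show "norm (c + u - z) \<le> L"
          by (simp add: dist_norm)
      qed
      have "g t + u \<in> D" if "t \<in> {0..1}" for t
        using tube[OF that] u by (auto simp: dist_norm)
      then show ?thesis
        unfolding J\<^sub>1_def J\<^sub>2_def J\<^sub>3_def
        using seg[OF x(2)] seg[OF y(2)] len[OF x(2)] len[OF y(2)] tube[of 0] tube[of 1] g01 x(1) y(1) L
        by (intro adm_joining_paths_three_pieces[OF \<rho> L(3) \<open>continuous_on UNIV g\<close>]) auto
    qed
    \<comment> \<open>Instead of selecting one shift, the lower bound is integrated over all of
      them, which leads to W \<le> W / 2.\<close>
    have "ennreal W = (\<integral>\<^sup>+u\<in>ball (0::'a) r. 1 \<partial>lborel)"
      using emeasure_lborel_ball_finite[of "0::'a" r] by (simp add: W_def emeasure_eq_ennreal_measure)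
    also have "\<dots> \<le> (\<integral>\<^sup>+u. ennreal L *
        (J\<^sub>1 u * indicator (ball 0 r) u + J\<^sub>2 u * indicator (ball 0 r) u + J\<^sub>3 u * indicator (ball 0 r) u) \<partial>lborel)"
      using lower by (intro nn_integral_mono) (auto simp: indicator_def)
    also have "\<dots> = ennreal L * ((\<integral>\<^sup>+u\<in>ball 0 r. J\<^sub>1 u \<partial>lborel) +
        (\<integral>\<^sup>+u\<in>ball 0 r. J\<^sub>2 u \<partial>lborel) + (\<integral>\<^sup>+u\<in>ball 0 r. J\<^sub>3 u \<partial>lborel))"
      by (simp add: nn_integral_cmult nn_integral_add)
    also have "\<dots> \<le> ennreal L * (ennreal (C\<^sub>1 * \<eta>) + ennreal ((W + r) * \<eta>) + ennreal (C\<^sub>1 * \<eta>))"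
      by (intro mult_left_mono add_mono avg1 avg2 avg3) simp
    also have "\<dots> = ennreal (L * (C * \<eta>))"
      using \<open>0 \<le> C\<^sub>1\<close> \<open>0 < \<eta>\<close> \<open>0 < W\<close> r L
      by (simp add: C_def algebra_simps flip: ennreal_plus ennreal_mult)
    also have "L * (C * \<eta>) = W / 2"
      using L \<open>0 < C\<close> by (simp add: \<eta>_def)
    finally show False
      using \<open>0 < W\<close> by simp
  qed
  then have "ennreal m \<le> modulus p (joining_paths A A' D)"
    unfolding modulus_def by (rule INF_greatest)
  with \<open>0 < m\<close> show ?thesis
    by (auto intro: less_le_trans[of _ "ennreal m"])
qed

theorem theorem1p1:
  fixes D A A' :: "(real ^ 'n) set" and p :: real
  assumes "CARD('n) \<ge> 2"
    and "open D" and "connected D"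
    and "p > real CARD('n) - 1"
    and "nondegenerate_continuum A" and "A \<subseteq> D"
    and "nondegenerate_continuum A'" and "A' \<subseteq> D"
  shows "modulus p (joining_paths A A' D) > 0"
  using assms by (intro modulus_joining_paths_pos) auto

end
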